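(* Let $p,q$ be positive integers with $p\ge q$. For every $\epsilon>0$ there exists an integer $n_0$ such that for every $n\ge n_0$, $$a(p,q;K_{1,n})\ \ge\ a^*(p,q;K_{1,n})\ \ge\ \left(1+\frac{q}{2p}-\epsilon\right)n,$$ where $K_{1,n}$ is the star with $n$ edges.
   Context: Let $p\ge q\ge 1$ be integers and $G$ a finite graph without isolated vertices. In both games below, played on the edges of the complete graph $K_N$ (all initially uncolored), each round consists of Alice first coloring $p$ uncolored edges blue and then Bob coloring $q$ uncolored edges red. In the $(p,q)$-achievement game, the player who first completes a copy of $G$ entirely in his or her own color wins (otherwise a draw); $a(p,q;G)$ is the smallest $N$ for which Alice has a winning strategy in it on $K_N$. In the first player game (a Maker/Breaker game), Alice wins if at some point the blue edges contain a copy of $G$, and Bob wins otherwise; $a^*(p,q;G)$ is the smallest $N$ for which Alice has a winning strategy in it on $K_N$. *)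

theory Defs
  imports Complex_Main "HOL-Library.Ramsey"
begin

text \<open>
  A finite graph without isolated vertices is represented by its set of edges, each edge being a
  two-element set of vertices; its vertex set is then the union of the edges.
\<close>

definition contains_copy :: "'a set set \<Rightarrow> 'b set set \<Rightarrow> bool" where
  "contains_copy G C \<longleftrightarrow> (\<exists>f. inj_on f (\<Union>G) \<and> (\<forall>e\<in>G. f ` e \<in> C))"

definition complete_graph :: "nat \<Rightarrow> nat set set" where
  "complete_graph N = nsets {..<N} 2"

definition star :: "nat \<Rightarrow> nat set set" where
  "star n = (\<lambda>i. {0, i}) ` {1..n}"

text \<open>
  A play is a pair of sequences: \<open>\<alpha> k\<close> and \<open>\<beta> k\<close> are the sets of edges coloured by Alice and by Bob
  in round \<open>k\<close> (rounds are numbered from 0, and Alice moves first in each round). A player who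
  has to colour \<open>m\<close> edges when fewer than \<open>m\<close> are uncoloured colours all of them; so every
  play can be continued forever, with empty moves once the board is exhausted.
\<close>

definition legal_move :: "nat \<Rightarrow> 'e set \<Rightarrow> 'e set \<Rightarrow> bool" where
  "legal_move m U M \<longleftrightarrow> M \<subseteq> U \<and> card M = min m (card U)"

definition alice_legal :: "nat \<Rightarrow> 'e set \<Rightarrow> (nat \<Rightarrow> 'e set) \<Rightarrow> (nat \<Rightarrow> 'e set) \<Rightarrow> bool" where
  "alice_legal p E \<alpha> \<beta> \<longleftrightarrow>
     (\<forall>k. legal_move p (E - ((\<Union>i<k. \<alpha> i) \<union> (\<Union>i<k. \<beta> i))) (\<alpha> k))"

definition bob_legal :: "nat \<Rightarrow> 'e set \<Rightarrow> (nat \<Rightarrow> 'e set) \<Rightarrow> (nat \<Rightarrow> 'e set) \<Rightarrow> bool" where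
  "bob_legal q E \<alpha> \<beta> \<longleftrightarrow>
     (\<forall>k. legal_move q (E - ((\<Union>i\<le>k. \<alpha> i) \<union> (\<Union>i<k. \<beta> i))) (\<beta> k))"

text \<open>
  A strategy for Alice maps the list of Bob's moves so far to her next move; her own earlier moves
  are determined by that list.
\<close>

definition alice_moves :: "('e set list \<Rightarrow> 'e set) \<Rightarrow> (nat \<Rightarrow> 'e set) \<Rightarrow> nat \<Rightarrow> 'e set" where
  "alice_moves \<sigma> \<beta> k = \<sigma> (map \<beta> [0..<k])"

definition alice_has_winning_strategy ::
  "nat \<Rightarrow> nat \<Rightarrow> 'e set \<Rightarrow> ((nat \<Rightarrow> 'e set) \<Rightarrow> (nat \<Rightarrow> 'e set) \<Rightarrow> bool) \<Rightarrow> bool" where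
  "alice_has_winning_strategy p q E wins \<longleftrightarrow>
     (\<exists>\<sigma>. \<forall>\<beta>. bob_legal q E (alice_moves \<sigma> \<beta>) \<beta> \<longrightarrow>
        alice_legal p E (alice_moves \<sigma> \<beta>) \<beta> \<and> wins (alice_moves \<sigma> \<beta>) \<beta>)"

text \<open>
  In the achievement game Alice wins if, after some turn of hers, blue contains a copy of \<open>G\<close> while
  red, as coloured in the earlier rounds, does not. What is played after the game is decided has
  no influence on this condition.
\<close>

definition achievement_win :: "'a set set \<Rightarrow> (nat \<Rightarrow> 'b set set) \<Rightarrow> (nat \<Rightarrow> 'b set set) \<Rightarrow> bool" where
  "achievement_win G \<alpha> \<beta> \<longleftrightarrow>
     (\<exists>k. contains_copy G (\<Union>i\<le>k. \<alpha> i) \<and> \<not> contains_copy G (\<Union>i<k. \<beta> i))"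

definition maker_win :: "'a set set \<Rightarrow> (nat \<Rightarrow> 'b set set) \<Rightarrow> (nat \<Rightarrow> 'b set set) \<Rightarrow> bool" where
  "maker_win G \<alpha> \<beta> \<longleftrightarrow> (\<exists>k. contains_copy G (\<Union>i\<le>k. \<alpha> i))"

definition achievement_number :: "nat \<Rightarrow> nat \<Rightarrow> 'a set set \<Rightarrow> nat" where
  "achievement_number p q G =
     (LEAST N. alice_has_winning_strategy p q (complete_graph N) (achievement_win G))"

definition first_player_number :: "nat \<Rightarrow> nat \<Rightarrow> 'a set set \<Rightarrow> nat" where
  "first_player_number p q G =
     (LEAST N. alice_has_winning_strategy p q (complete_graph N) (maker_win G))"

end

(*
  Give each vertex v the debt q * blue(v) - 2 * p * red(v). A turn of Alice adds at most 2pq to the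
  total debt, and q edges of Bob, each chosen at a vertex of maximal debt that still has an
  uncoloured edge, remove at least 2pq. As in box games, the debts then stay of order
  sqrt N = o(N). Since blue(v) + red(v) < N, every blue degree is at most
  N / (1 + q/(2p)) + o(N). For the other inequality it remains to see that Alice wins the
  achievement game on some board: if N is large she just plays at one vertex, and as q <= p
  there are fewer than n red edges when she completes her star.
*)

theory Submission
  imports Defs
begin

section \<open>Degrees in edge sets\<close>

definition degree :: "'a set set \<Rightarrow> 'a \<Rightarrow> nat" where
  "degree C v = card {e \<in> C. v \<in> e}"

lemma finite_complete_graph: "finite (complete_graph N)"
  by (simp add: complete_graph_def finite_imp_finite_nsets)

lemma finite_Union_edges:
  assumes "finite C" "\<And>e. e \<in> C \<Longrightarrow> card e = 2"
  shows "finite (\<Union>C)"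
  using assms by (metis card.infinite finite_Union zero_neq_numeral)

lemma degree_Un_disjoint:
  assumes "finite C" "finite C'" "C \<inter> C' = {}"
  shows "degree (C \<union> C') v = degree C v + degree C' v"
proof -
  have "{e \<in> C \<union> C'. v \<in> e} = {e \<in> C. v \<in> e} \<union> {e \<in> C'. v \<in> e}" by blast
  then show ?thesis
    unfolding degree_def using assms by (subst card_Un_disjoint[symmetric]) auto
qed

lemma degree_insert:
  assumes "finite C" "e \<notin> C"
  shows "degree (insert e C) v = degree C v + of_bool (v \<in> e)"
proof -
  have "{e' \<in> insert e C. v \<in> e'} = (if v \<in> e then insert e {e \<in> C. v \<in> e} else {e \<in> C. v \<in> e})"
    by auto
  then show ?thesis
    unfolding degree_def using assms by simp
qed

text \<open>Double counting of incidences between \<open>A\<close> and \<open>C\<close>: each edge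
  meets \<open>A\<close> in at most two vertices.\<close>

lemma sum_degree_le:
  assumes "finite C" "\<And>e. e \<in> C \<Longrightarrow> card e = 2" "finite A"
  shows "(\<Sum>v\<in>A. degree C v) \<le> 2 * card C"
proof -
  have fin: "finite e" if "e \<in> C" for e
    using assms(2)[OF that] by (intro card_ge_0_finite) simp
  have "(\<Sum>v\<in>A. degree C v) = (\<Sum>v\<in>A. \<Sum>e\<in>C. of_bool (v \<in> e))"
    unfolding degree_def using assms(1)
    by (intro sum.cong) (simp_all add: Int_def)
  also have "\<dots> = (\<Sum>e\<in>C. \<Sum>v\<in>A. of_bool (v \<in> e))"
    by (rule sum.swap)
  also have "\<dots> = (\<Sum>e\<in>C. card (A \<inter> e))"
    using assms(3) by (intro sum.cong) (simp_all add: Int_def)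
  also have "\<dots> \<le> (\<Sum>e\<in>C. 2)"
  proof (rule sum_mono)
    fix e assume "e \<in> C"
    then show "card (A \<inter> e) \<le> 2"
      using assms(2) fin by (metis card_mono inf_le2)
  qed
  finally show ?thesis by simp
qed

lemma degree_complete_graph: "degree (complete_graph N) v \<le> N - 1"
proof (cases "v < N")
  case False
  then have "{e \<in> complete_graph N. v \<in> e} = {}"
    by (auto simp: complete_graph_def nsets_def)
  then show ?thesis by (simp only: degree_def) simp
next
  case True
  have "{e \<in> complete_graph N. v \<in> e} \<subseteq> (\<lambda>w. {v, w}) ` ({..<N} - {v})"
  proof
    fix e assume e: "e \<in> {e \<in> complete_graph N. v \<in> e}"
    then obtain a b where "e = {a, b}" "a \<noteq> b" "e \<subseteq> {..<N}"
      by (auto simp: complete_graph_def nsets_def card_2_iff)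
    then show "e \<in> (\<lambda>w. {v, w}) ` ({..<N} - {v})"
      using e by (auto simp: insert_commute)
  qed
  then have "degree (complete_graph N) v \<le> card ((\<lambda>w. {v, w}) ` ({..<N} - {v}))"
    unfolding degree_def by (intro card_mono) auto
  also have "\<dots> \<le> card ({..<N} - {v})"
    by (rule card_image_le) simp
  finally show ?thesis using True by simp
qed

subsection \<open>Stars\<close>

text \<open>The image of the centre 0 is such a vertex, because an embedding sends distinct edges of
  the star to distinct edges of \<open>C\<close>.\<close>

lemma degree_ge_if_contains_star:
  assumes "contains_copy (star n) C" "finite C"
  shows "\<exists>v. n \<le> degree C v"
proof -
  obtain f where inj: "inj_on f (\<Union>(star n))" and f: "\<And>e. e \<in> star n \<Longrightarrow> f ` e \<in> C"
    using assms(1) by (auto simp: contains_copy_def)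
  have "inj_on (\<lambda>i. f ` {0, i}) {1..n}"
  proof (rule inj_onI)
    fix i j assume ij: "i \<in> {1..n}" "j \<in> {1..n}" "f ` {0, i} = f ` {0, j}"
    have mem: "k \<in> \<Union>(star n) \<and> 0 \<in> \<Union>(star n)" if "k \<in> {1..n}" for k
      using that by (auto simp: star_def)
    have "f i = f j"
      using ij(3) by (auto simp: doubleton_eq_iff)
    then show "i = j"
      using inj ij mem by (auto dest: inj_onD)
  qed
  moreover have "(\<lambda>i. f ` {0, i}) ` {1..n} \<subseteq> {e \<in> C. f 0 \<in> e}"
  proof (rule image_subsetI)
    fix i assume "i \<in> {1..n}"
    then have "f ` {0, i} \<in> C"
      by (intro f) (auto simp: star_def)
    then show "f ` {0, i} \<in> {e \<in> C. f 0 \<in> e}" by simp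
  qed
  ultimately have "card {1..n} \<le> degree C (f 0)"
    unfolding degree_def using assms(2) by (intro card_inj_on_le) auto
  then show ?thesis by auto
qed

text \<open>Take \<open>v\<close> as the centre and any \<open>n\<close> of its neighbours as
  leaves. Inside a complete graph every edge at \<open>v\<close> has exactly one other endpoint, so
  edges at \<open>v\<close> can be traded for neighbours.\<close>

lemma contains_star_if_degree_ge:
  assumes "C \<subseteq> complete_graph N" "n \<le> degree C v"
  shows "contains_copy (star n) C"
proof -
  define W where "W = {w. w \<noteq> v \<and> {v, w} \<in> C}"
  have two: "e \<in> C \<Longrightarrow> e \<subseteq> {..<N} \<and> card e = 2" for e
    using assms(1) by (auto simp: complete_graph_def nsets_def)
  have "finite W"
    by (rule finite_subset[of _ "{..<N}"]) (auto simp: W_def dest: two)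
  have "{e \<in> C. v \<in> e} \<subseteq> (\<lambda>w. {v, w}) ` W"
  proof
    fix e assume e: "e \<in> {e \<in> C. v \<in> e}"
    then obtain a b where "e = {a, b}" "a \<noteq> b"
      using two[of e] by (auto simp: card_2_iff)
    then show "e \<in> (\<lambda>w. {v, w}) ` W"
      using e by (auto simp: W_def insert_commute)
  qed
  then have "degree C v \<le> card W"
    unfolding degree_def using \<open>finite W\<close> by (rule surj_card_le[rotated])
  then obtain W' where W': "W' \<subseteq> W" "card W' = n"
    using assms(2) by (meson le_trans obtain_subset_with_card_n)
  then have "finite W'" using \<open>finite W\<close> finite_subset by blast
  then obtain h where h: "bij_betw h {1..n} W'"
    using W'(2) by (metis card_atLeastAtMost diff_Suc_1 finite_atLeastAtMost finite_same_card_bij)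
  define f where "f = h(0 := v)"
  have f0: "f 0 = v" by (simp add: f_def)
  have fi: "f i = h i" "f i \<in> W" if "i \<in> {1..n}" for i
    using that h W'(1) by (auto simp: f_def bij_betw_def)
  have "inj_on f (insert 0 {1..n})"
  proof -
    have "inj_on f {1..n}"
      using h inj_on_cong[of "{1..n}" f h] fi(1) by (simp add: bij_betw_def)
    moreover have "f i \<noteq> f 0" if "i \<in> {1..n}" for i
      using fi(2)[OF that] f0 by (simp add: W_def)
    ultimately show ?thesis
      unfolding inj_on_insert by (auto simp: image_iff dest: sym)
  qed
  moreover have "\<Union>(star n) \<subseteq> insert 0 {1..n}"
    by (auto simp: star_def)
  moreover have "f ` e \<in> C" if "e \<in> star n" for e
    using that fi(2) f0 by (auto simp: star_def W_def)
  ultimately show ?thesis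
    unfolding contains_copy_def by (meson inj_on_subset)
qed

lemma not_contains_star_if_card_less:
  assumes "finite C" "card C < n"
  shows "\<not> contains_copy (star n) C"
proof
  assume "contains_copy (star n) C"
  then obtain v where "n \<le> degree C v"
    using assms(1) degree_ge_if_contains_star by blast
  also have "degree C v \<le> card C"
    unfolding degree_def using assms(1) by (intro card_mono) auto
  finally show False using assms(2) by simp
qed

subsection \<open>Large boards: Alice builds her star first\<close>

lemma ex_legal_move: "\<exists>M. legal_move m U M"
  by (metis legal_move_def min.cobounded2 obtain_subset_with_card_n)

lemma ex_legal_move_within:
  assumes "finite U"
  shows "\<exists>M. legal_move m U M \<and> (m \<le> card (U \<inter> S) \<longrightarrow> M \<subseteq> S)"
proof (cases "m \<le> card (U \<inter> S)")
  case True
  then obtain M where M: "M \<subseteq> U \<inter> S" "card M = m"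
    by (meson obtain_subset_with_card_n)
  moreover have "m \<le> card U"
    using True assms by (meson card_mono inf_le1 le_trans)
  ultimately show ?thesis
    by (auto simp: legal_move_def)
next
  case False
  then show ?thesis using ex_legal_move by blast
qed

text \<open>Alice has to move legally in every round, also after her star is complete. Hence a total
  rule that falls back on an arbitrary legal move once \<open>S\<close> has too few free
  edges.\<close>

definition stay_within :: "nat \<Rightarrow> 'e set \<Rightarrow> 'e set \<Rightarrow> 'e set" where
  "stay_within m S U = (SOME M. legal_move m U M \<and> (m \<le> card (U \<inter> S) \<longrightarrow> M \<subseteq> S))"

lemma stay_within:
  assumes "finite U"
  shows "legal_move m U (stay_within m S U)"
    and "m \<le> card (U \<inter> S) \<Longrightarrow> stay_within m S U \<subseteq> S"
  using someI_ex[OF ex_legal_move_within[OF assms, of m S]] by (auto simp: stay_within_def)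

text \<open>A strategy sees only Bob's moves, whereas a rule \<open>g\<close> reads the blue and red
  edges; this recursion reconstructs the blue ones.\<close>

primrec blue_upto :: "('e set \<Rightarrow> 'e set \<Rightarrow> 'e set) \<Rightarrow> (nat \<Rightarrow> 'e set) \<Rightarrow> nat \<Rightarrow> 'e set" where
  "blue_upto g \<beta> 0 = {}"
| "blue_upto g \<beta> (Suc k) = blue_upto g \<beta> k \<union> g (blue_upto g \<beta> k) (\<Union>i<k. \<beta> i)"

lemma blue_upto_cong:
  "(\<And>i. i < k \<Longrightarrow> \<beta> i = \<beta>' i) \<Longrightarrow> blue_upto g \<beta> k = blue_upto g \<beta>' k"
  by (induction k) auto

lemma ex_positional_strategy:
  "\<exists>\<sigma>. \<forall>\<beta> k. alice_moves \<sigma> \<beta> k = g (\<Union>i<k. alice_moves \<sigma> \<beta> i) (\<Union>i<k. \<beta> i)"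
proof -
  define \<sigma> where "\<sigma> L = g (blue_upto g ((!) L) (length L)) (\<Union>i<length L. L ! i)" for L
  have move: "alice_moves \<sigma> \<beta> k = g (blue_upto g \<beta> k) (\<Union>i<k. \<beta> i)" for \<beta> k
  proof -
    have "blue_upto g ((!) (map \<beta> [0..<k])) k = blue_upto g \<beta> k"
      by (rule blue_upto_cong) simp
    then show ?thesis by (simp add: alice_moves_def \<sigma>_def)
  qed
  have "blue_upto g \<beta> k = (\<Union>i<k. alice_moves \<sigma> \<beta> i)" for \<beta> k
    by (induction k) (auto simp: move lessThan_Suc)
  then show ?thesis using move by metis
qed

lemma card_red_le:
  assumes "bob_legal q E \<alpha> \<beta>"
  shows "card (\<Union>i<k. \<beta> i) \<le> q * k"
proof -
  have "card (\<Union>i<k. \<beta> i) \<le> (\<Sum>i<k. card (\<beta> i))"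
    by (rule card_UN_le) simp
  also have "\<dots> \<le> (\<Sum>i<k. q)"
    using assms by (intro sum_mono) (simp add: bob_legal_def legal_move_def)
  finally show ?thesis by (simp add: mult.commute)
qed

lemma bob_legal_subset: "bob_legal q E \<alpha> \<beta> \<Longrightarrow> \<beta> k \<subseteq> E - ((\<Union>i\<le>k. \<alpha> i) \<union> (\<Union>i<k. \<beta> i))"
  by (simp add: bob_legal_def legal_move_def)

lemma alice_wins_achievement_star:
  assumes "q \<le> p" "q \<ge> 1" "n \<ge> 1"
  shows "\<exists>N. alice_has_winning_strategy p q (complete_graph N) (achievement_win (star n))"
proof -
  \<comment> \<open>Before each turn that counts, fewer than \<open>n\<close> edges are blue and
    fewer than \<open>n\<close> are red, so at least \<open>p\<close> of the \<open>N - 1\<close>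
    edges at vertex 0 are still free.\<close>
  define N where "N = 3 * n + 3 * p + 1"
  define E where "E = complete_graph N"
  define S where "S = (\<lambda>w. {0, w}) ` {1..<N}"
  have finE: "finite E" by (simp add: E_def finite_complete_graph)
  have SE: "S \<subseteq> E"
    by (auto simp: S_def E_def complete_graph_def nsets_def)
  have cardS: "card S = N - 1"
    unfolding S_def by (subst card_image) (auto simp: inj_on_def doubleton_eq_iff)
  obtain \<sigma> where \<sigma>: "\<And>\<beta> k. alice_moves \<sigma> \<beta> k =
      stay_within p S (E - ((\<Union>i<k. alice_moves \<sigma> \<beta> i) \<union> (\<Union>i<k. \<beta> i)))"
    using ex_positional_strategy[of "\<lambda>B R. stay_within p S (E - (B \<union> R))"] by blast
  have "alice_legal p E (alice_moves \<sigma> \<beta>) \<beta> \<and> achievement_win (star n) (alice_moves \<sigma> \<beta>) \<beta>"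
    if bl: "bob_legal q E (alice_moves \<sigma> \<beta>) \<beta>" for \<beta>
  proof
    define \<alpha> where "\<alpha> = alice_moves \<sigma> \<beta>"
    define U where "U k = E - ((\<Union>i<k. \<alpha> i) \<union> (\<Union>i<k. \<beta> i))" for k
    have \<alpha>: "\<alpha> k = stay_within p S (U k)" for k
      using \<sigma>[of \<beta> k] by (simp add: \<alpha>_def U_def)
    have finU: "finite (U k)" for k using finE by (simp add: U_def)
    have legal: "legal_move p (U k) (\<alpha> k)" for k
      unfolding \<alpha> by (rule stay_within(1)[OF finU])
    show "alice_legal p E (alice_moves \<sigma> \<beta>) \<beta>"
      using legal by (simp add: alice_legal_def U_def \<alpha>_def)
    have red: "card (\<Union>i<k. \<beta> i) \<le> p * k" for k
      using card_red_le[OF bl, of k] assms(1) by (meson le_trans mult_le_mono1)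
    have finR: "finite (\<Union>i<k. \<beta> i)" for k
      using finE bob_legal_subset[OF bl] by (meson Diff_subset UN_least finite_subset order_trans)
    \<comment> \<open>For \<open>Suc k\<close> the guard says \<open>p * k < n\<close>, so the
      invariant reaches just past the turn that completes the star.\<close>
    have inv: "(\<Union>i<k. \<alpha> i) \<subseteq> S \<and> card (\<Union>i<k. \<alpha> i) = p * k" if "p * k < n + p" for k
      using that
    proof (induction k)
      case 0 show ?case by simp
    next
      case (Suc k)
      let ?B = "\<Union>i<k. \<alpha> i" and ?R = "\<Union>i<k. \<beta> i"
      have IH: "?B \<subseteq> S" "card ?B = p * k" and "p * k < n" using Suc by auto
      have finS: "finite S" using SE finE finite_subset by blast
      have "U k \<inter> S = S - (?B \<union> ?R)" using SE by (auto simp: U_def)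
      moreover have "card S - card (?B \<union> ?R) \<le> card (S - (?B \<union> ?R))"
        using finR finS IH(1) by (intro diff_card_le_card_Diff finite_UnI finite_subset[OF IH(1)])
      moreover have "card (?B \<union> ?R) \<le> 2 * (p * k)"
        using card_Un_le[of ?B ?R] IH(2) red[of k] by simp
      ultimately have enough: "p \<le> card (U k \<inter> S)"
        using cardS \<open>p * k < n\<close> by (simp add: N_def)
      have fins: "finite ?B" "finite (\<alpha> k)"
        using finite_subset[OF IH(1) finS] finite_subset[OF _ finU] legal[of k]
        by (auto simp: legal_move_def)
      have "p \<le> card (U k)" using enough finU by (meson card_mono inf_le1 le_trans)
      then have "card (\<alpha> k) = p" "\<alpha> k \<subseteq> U k" using legal[of k] by (auto simp: legal_move_def)
      moreover have "\<alpha> k \<subseteq> S" unfolding \<alpha> by (rule stay_within(2)[OF finU enough])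
      moreover have "card (?B \<union> \<alpha> k) = card ?B + card (\<alpha> k)"
        using \<open>\<alpha> k \<subseteq> U k\<close> by (intro card_Un_disjoint fins) (auto simp: U_def)
      ultimately show ?case using IH by (simp add: lessThan_Suc Un_commute)
    qed
    \<comment> \<open>The last round before which Alice has fewer than \<open>n\<close> edges. Bob
      has coloured at most \<open>p * k\<close> edges by then, too few for a star.\<close>
    define k where "k = (n - 1) div p"
    have k: "p * k < n" "n \<le> p * Suc k"
      using assms mult_div_mod_eq[of p "n - 1"] dividend_less_times_div[of p "n - 1"]
      unfolding k_def by (linarith, simp)
    then have B: "(\<Union>i\<le>k. \<alpha> i) \<subseteq> S" "card (\<Union>i\<le>k. \<alpha> i) = p * Suc k"
      using inv[of "Suc k"] by (auto simp: lessThan_Suc_atMost)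
    have "{e \<in> \<Union>i\<le>k. \<alpha> i. 0 \<in> e} = (\<Union>i\<le>k. \<alpha> i)"
      using B(1) by (auto simp: S_def)
    then have "n \<le> degree (\<Union>i\<le>k. \<alpha> i) 0"
      using B(2) k(2) by (simp add: degree_def)
    then have "contains_copy (star n) (\<Union>i\<le>k. \<alpha> i)"
      using B(1) SE E_def contains_star_if_degree_ge by (metis order_trans)
    moreover have "\<not> contains_copy (star n) (\<Union>i<k. \<beta> i)"
      using red[of k] k(1) finR by (intro not_contains_star_if_card_less) auto
    ultimately show "achievement_win (star n) (alice_moves \<sigma> \<beta>) \<beta>"
      unfolding achievement_win_def \<alpha>_def by blast
  qed
  then show ?thesis
    unfolding alice_has_winning_strategy_def E_def by blast
qed

subsection \<open>Bob's greedy defence\<close>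

definition debt :: "nat \<Rightarrow> nat \<Rightarrow> 'a set set \<Rightarrow> 'a set set \<Rightarrow> 'a \<Rightarrow> real" where
  "debt p q B R v = real q * real (degree B v) - 2 * real p * real (degree R v)"

text \<open>
  All that matters is that the bound drops by at least \<open>2pq / (j + 1)\<close> from \<open>j\<close> to \<open>j + 1\<close> and is
  nonnegative for \<open>j \<le> N\<close>; square roots avoid harmonic sums.
\<close>

definition debt_bound :: "nat \<Rightarrow> nat \<Rightarrow> nat \<Rightarrow> nat \<Rightarrow> real" where
  "debt_bound p q N j = 4 * real p * real q * (sqrt (real N) - sqrt (real j))"

text \<open>
  Average debts are controlled only on vertices that still have an uncoloured edge; the other
  ones are out of Bob's reach, but their debt no longer changes. The parameter \<open>i\<close> is the number
  of edges that Bob may still colour in the current round.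
\<close>

definition balanced :: "nat \<Rightarrow> nat \<Rightarrow> nat \<Rightarrow> 'a set set \<Rightarrow> nat \<Rightarrow> 'a set set \<Rightarrow> 'a set set \<Rightarrow> bool" where
  "balanced p q N E i B R \<longleftrightarrow>
     (\<forall>A. A \<noteq> {} \<longrightarrow> A \<subseteq> \<Union>(E - (B \<union> R)) \<longrightarrow>
        (\<Sum>v\<in>A. debt p q B R v) \<le> real (card A) * debt_bound p q N (card A) + 2 * real p * real i)"

text \<open>With \<open>a\<close> the larger and \<open>b\<close> the smaller root, 1 = (a - b)(a +
  b) and a + b <= 2a <= 2a^2, where a^2 = j + 1.\<close>

lemma sqrt_Suc_diff_ge: "1 / 2 \<le> (real j + 1) * (sqrt (real j + 1) - sqrt (real j))"
proof -
  define a b where "a = sqrt (real j + 1)" and "b = sqrt (real j)"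
  have ab: "a \<ge> 1" "b \<ge> 0" "b \<le> a" and sq: "a * a = real j + 1" "b * b = real j"
    by (simp_all add: a_def b_def)
  have "1 = (a - b) * (a + b)" using sq by (simp add: algebra_simps)
  also have "\<dots> \<le> (a - b) * (2 * (a * a))"
    using ab mult_left_mono[of 1 a a] by (intro mult_left_mono) linarith+
  finally show ?thesis
    using sq by (simp add: a_def b_def algebra_simps)
qed

text \<open>The factor 4 in \<open>debt_bound\<close> is chosen so that, after the loss of 1/2 in
  \<open>sqrt_Suc_diff_ge\<close>, the full 2pq remains.\<close>

lemma debt_bound_diff:
  "2 * real p * real q \<le> (real j + 1) * (debt_bound p q N j - debt_bound p q N (Suc j))"
proof -
  have "4 * real p * real q * (1 / 2) \<le>
      4 * real p * real q * ((real j + 1) * (sqrt (real j + 1) - sqrt (real j)))"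
    by (intro mult_left_mono sqrt_Suc_diff_ge) simp
  then show ?thesis by (simp add: debt_bound_def algebra_simps)
qed

text \<open>Call a vertex live if it has an uncoloured edge. Bob colours an edge at a live vertex
  \<open>w\<close> of maximal debt. Sets containing \<open>w\<close> lose at least 2p, which pays
  for the decrease of \<open>i\<close>. For the other sets the drop of \<open>debt_bound\<close>
  from \<open>card A\<close> to \<open>card A + 1\<close> absorbs the whole slack.\<close>

lemma greedy_edge:
  assumes E: "finite E" "\<And>e. e \<in> E \<Longrightarrow> card e = 2" and R: "finite R"
    and U: "E - (B \<union> R) \<noteq> {}" and i: "Suc i \<le> q" and bal: "balanced p q N E (Suc i) B R"
  shows "\<exists>e \<in> E - (B \<union> R). balanced p q N E i B (insert e R)"
proof -
  let ?U = "E - (B \<union> R)" and ?d = "debt p q B R"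
  have fin: "finite (\<Union>?U)"
    using finite_Union_edges[of ?U] E by blast
  obtain e\<^sub>0 where "e\<^sub>0 \<in> ?U"
    using U by blast
  moreover from this have "e\<^sub>0 \<noteq> {}"
    using E(2)[of e\<^sub>0] by auto
  ultimately have "\<Union>?U \<noteq> {}"
    by blast
  then have "Max (?d ` \<Union>?U) \<in> ?d ` \<Union>?U"
    using fin by (intro Max_in) auto
  then obtain w where w: "w \<in> \<Union>?U" and "?d w = Max (?d ` \<Union>?U)"
    by (metis imageE)
  then have w_max: "?d v \<le> ?d w" if "v \<in> \<Union>?U" for v
    using fin that by (simp del: Union_iff)
  obtain e where e: "e \<in> ?U" "w \<in> e" using w by blast
  have new: "debt p q B (insert e R) v = ?d v - 2 * real p * of_bool (v \<in> e)" for v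
    using e R by (simp add: debt_def degree_insert algebra_simps)
  have "(\<Sum>v\<in>A. debt p q B (insert e R) v)
      \<le> real (card A) * debt_bound p q N (card A) + 2 * real p * real i"
    if A: "A \<noteq> {}" "A \<subseteq> \<Union>(E - (B \<union> insert e R))" for A
  proof -
    \<comment> \<open>Colouring \<open>e\<close> creates no live vertices, so the hypothesis covers
      \<open>A\<close>.\<close>
    have AU: "A \<subseteq> \<Union>?U" using A(2) by blast
    then have finA: "finite A" using fin finite_subset by blast
    let ?j = "card A"
    let ?s = "\<Sum>v\<in>A. ?d v"
    have sum_le: "(\<Sum>v\<in>A. debt p q B (insert e R) v) \<le> ?s - 2 * real p * of_bool (w \<in> A)"
    proof -
      have "(of_bool (w \<in> A) :: real) \<le> (\<Sum>v\<in>A. of_bool (v \<in> e))"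
        using finA e(2) member_le_sum[of w A "\<lambda>v. of_bool (v \<in> e) :: real"]
        by (auto simp: sum_nonneg)
      then have "2 * real p * of_bool (w \<in> A) \<le> 2 * real p * (\<Sum>v\<in>A. of_bool (v \<in> e))"
        by (intro mult_left_mono) auto
      then show ?thesis
        by (simp add: new sum_subtractf sum_distrib_left)
    qed
    show ?thesis
    proof (cases "w \<in> A")
      case True
      have "?s \<le> real ?j * debt_bound p q N ?j + 2 * real p * real (Suc i)"
        using bal A(1) AU by (auto simp: balanced_def)
      then show ?thesis using sum_le True by (simp add: algebra_simps)
    next
      case False
      have j: "real ?j > 0" using A(1) finA by (simp add: card_gt_0_iff)
      have "?s \<le> real ?j * ?d w"
        using AU by (intro sum_bounded_above w_max) blast
      \<comment> \<open>\<open>w\<close> is at least as indebted as the average of \<open>A\<close>, so the bound for \<open>insert w A\<close> applies to \<open>A\<close>.\<close>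
      moreover have "?s + ?d w \<le> (real ?j + 1) * debt_bound p q N (Suc ?j) + 2 * real p * real (Suc i)"
        using bal[unfolded balanced_def, rule_format, of "insert w A"] w AU finA False
        by (simp add: algebra_simps)
      then have "real ?j * (?s + ?d w) \<le>
          real ?j * ((real ?j + 1) * debt_bound p q N (Suc ?j) + 2 * real p * real (Suc i))"
        by (intro mult_left_mono) auto
      \<comment> \<open>The slack never exceeds 2pq, the amount that \<open>debt_bound_diff\<close>
        provides.\<close>
      moreover have "2 * real p * real (Suc i) \<le> 2 * real p * real q"
        using i by (intro mult_left_mono) auto
      then have "2 * real p * real (Suc i) \<le>
          (real ?j + 1) * (debt_bound p q N ?j - debt_bound p q N (Suc ?j))"
        using debt_bound_diff[of p q ?j N] by linarith
      then have "real ?j * (2 * real p * real (Suc i)) \<le>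
          real ?j * ((real ?j + 1) * (debt_bound p q N ?j - debt_bound p q N (Suc ?j)))"
        by (intro mult_left_mono) auto
      \<comment> \<open>As \<open>?d w\<close> is at least the average of \<open>A\<close>,
        j(\<open>?s\<close> + \<open>?d w\<close>) is at least (j + 1)\<open>?s\<close> for j =
        \<open>?j\<close>.\<close>
      ultimately have "(real ?j + 1) * ?s \<le> (real ?j + 1) * (real ?j * debt_bound p q N ?j)"
        by (simp add: algebra_simps)
      then have "?s \<le> real ?j * debt_bound p q N ?j"
        using j by (subst (asm) mult_le_cancel_left_pos) auto
      then show ?thesis using sum_le False by (simp add: add_increasing2)
    qed
  qed
  then show ?thesis using e(1) unfolding balanced_def by blast
qed

text \<open>Iterates \<open>greedy_edge\<close>; each edge uses up 2p of the slack.\<close>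

lemma greedy_move:
  assumes E: "finite E" "\<And>e. e \<in> E \<Longrightarrow> card e = 2" and "finite R"
    and "i \<le> q" "balanced p q N E i B R"
  shows "\<exists>M. legal_move i (E - (B \<union> R)) M \<and> balanced p q N E 0 B (R \<union> M)"
  using assms(3-5)
proof (induction i arbitrary: R)
  case 0
  then show ?case by (intro exI[of _ "{}"]) (simp add: legal_move_def)
next
  case (Suc i)
  show ?case
  proof (cases "E - (B \<union> R) = {}")
    \<comment> \<open>On an exhausted board no vertex is live: the empty move is legal and
      \<open>balanced\<close> holds vacuously.\<close>
    case True
    then show ?thesis
      using Suc.prems(3) by (intro exI[of _ "{}"]) (auto simp: legal_move_def balanced_def True)
  next
    case False
    let ?U = "E - (B \<union> R)"
    obtain e where e: "e \<in> ?U" "balanced p q N E i B (insert e R)"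
      using greedy_edge[OF E Suc.prems(1) False Suc.prems(2,3)] by blast
    then obtain M where M: "legal_move i (E - (B \<union> insert e R)) M"
      "balanced p q N E 0 B (insert e R \<union> M)"
      using Suc.IH[of "insert e R"] Suc.prems by auto
    have eq: "E - (B \<union> insert e R) = ?U - {e}" by blast
    have sub: "M \<subseteq> ?U - {e}" and card: "card M = min i (card (?U - {e}))"
      using M(1) unfolding eq legal_move_def by blast+
    have "finite M" "e \<notin> M" using sub E(1) by (auto intro: finite_subset)
    moreover have "card ?U = Suc (card (?U - {e}))"
      using e(1) E(1) by (metis card_Suc_Diff1 finite_Diff)
    ultimately have "legal_move (Suc i) ?U (insert e M)"
      using sub card e(1) by (auto simp: legal_move_def)
    then show ?thesis using M(2) by (intro exI[of _ "insert e M"]) simp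
  qed
qed

text \<open>Each new blue edge adds at most 2q to the total debt of \<open>A\<close>, so a turn adds
  at most 2pq. This is exactly the slack that \<open>i = q\<close> grants.\<close>

lemma balanced_alice_move:
  assumes E: "\<And>e. e \<in> E \<Longrightarrow> card e = 2" "finite E"
    and B: "finite B" and M: "M \<subseteq> E - (B \<union> R)" "card M \<le> p"
    and bal: "balanced p q N E 0 B R"
  shows "balanced p q N E q (B \<union> M) R"
  unfolding balanced_def
proof (intro allI impI)
  fix A assume A: "A \<noteq> {}" "A \<subseteq> \<Union>(E - (B \<union> M \<union> R))"
  have finM: "finite M" using M E by (meson finite_Diff finite_subset)
  have "finite (\<Union>E)" using finite_Union_edges E by blast
  then have finA: "finite A" using A(2) by (meson Diff_subset Union_mono finite_subset)
  have "debt p q (B \<union> M) R v = debt p q B R v + real q * real (degree M v)" for v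
    using degree_Un_disjoint[OF B finM] M(1) by (force simp: debt_def algebra_simps)
  then have "(\<Sum>v\<in>A. debt p q (B \<union> M) R v)
      = (\<Sum>v\<in>A. debt p q B R v) + real q * real (\<Sum>v\<in>A. degree M v)"
    by (simp add: sum.distrib sum_distrib_left)
  also have "(\<Sum>v\<in>A. degree M v) \<le> 2 * p"
    using sum_degree_le[OF finM _ finA] M E(1) by fastforce
  then have "real q * real (\<Sum>v\<in>A. degree M v) \<le> real q * real (2 * p)"
    by (intro mult_left_mono) (simp_all only: of_nat_le_iff of_nat_0_le_iff)
  also have "(\<Sum>v\<in>A. debt p q B R v) \<le> real (card A) * debt_bound p q N (card A)"
    using bal[unfolded balanced_def, rule_format, of A] A by auto
  finally show "(\<Sum>v\<in>A. debt p q (B \<union> M) R v)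
      \<le> real (card A) * debt_bound p q N (card A) + 2 * real p * real q"
    by (simp add: algebra_simps)
qed

text \<open>The final estimate concerns every vertex, live or not. A live vertex is bounded through
  the singleton \<open>{v}\<close> and gains at most pq; a vertex without uncoloured edges keeps its
  old debt.\<close>

lemma debt_alice_move:
  assumes "finite E" "finite B" "M \<subseteq> E - (B \<union> R)" "card M \<le> p"
    and bal: "balanced p q N E 0 B R"
    and K: "debt p q B R v \<le> K" "debt_bound p q N 1 + real p * real q \<le> K"
  shows "debt p q (B \<union> M) R v \<le> K"
proof -
  have finM: "finite M" using assms by (meson finite_Diff finite_subset)
  have eq: "debt p q (B \<union> M) R v = debt p q B R v + real q * real (degree M v)"
    using degree_Un_disjoint[OF assms(2) finM] assms(3) by (force simp: debt_def algebra_simps)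
  show ?thesis
  proof (cases "v \<in> \<Union>(E - (B \<union> R))")
    case True
    have "degree M v \<le> card M"
      unfolding degree_def using finM by (intro card_mono) auto
    then have "real q * real (degree M v) \<le> real q * real p"
      using assms(4) by (intro mult_left_mono) auto
    moreover have "debt p q B R v \<le> debt_bound p q N 1"
      using bal[unfolded balanced_def, rule_format, of "{v}"] True by simp
    ultimately show ?thesis using eq K(2) by (simp add: mult.commute)
  next
    case False
    then have "{e \<in> M. v \<in> e} = {}" using assms(3) by blast
    then have "degree M v = 0" by (simp only: degree_def card.empty)
    then show ?thesis using eq K by simp
  qed
qed

section \<open>Playing a rule for Bob against a strategy of Alice\<close>

text \<open>The two players' moves depend on each other, but the list of Bob's moves determines
  everything, so recursion on that list yields the play.\<close>

lemma ex_response: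
  "\<exists>\<beta>. \<forall>k. \<beta> k = g (\<Union>i\<le>k. alice_moves \<sigma> \<beta> i) (\<Union>i<k. \<beta> i)"
proof -
  \<comment> \<open>In round \<open>i\<close> Alice has seen \<open>take i L\<close>. The index
    \<open>i = length L\<close> is included because Bob already sees her move of the current
    round.\<close>
  define \<tau> where "\<tau> L = g (\<Union>i\<le>length L. \<sigma> (take i L)) (\<Union>(set L))" for L
  define H where "H k = rec_nat [] (\<lambda>_ L. L @ [\<tau> L]) k" for k :: nat
  define \<beta> where "\<beta> k = \<tau> (H k)" for k
  have H: "map \<beta> [0..<k] = H k" for k
    by (induction k) (simp_all add: H_def \<beta>_def)
  have "\<beta> k = g (\<Union>i\<le>k. alice_moves \<sigma> \<beta> i) (\<Union>i<k. \<beta> i)" for k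
  proof -
    have "\<beta> k = \<tau> (map \<beta> [0..<k])" by (simp add: H \<beta>_def)
    moreover have "(\<Union>i\<le>k. \<sigma> (take i (map \<beta> [0..<k]))) = (\<Union>i\<le>k. alice_moves \<sigma> \<beta> i)"
      by (intro SUP_cong) (simp_all add: alice_moves_def take_map)
    ultimately show ?thesis by (simp add: \<tau>_def atLeast0LessThan)
  qed
  then show ?thesis by blast
qed

text \<open>Alice's strategy is matched against the greedy defence. The resulting play satisfies the
  abstract winning condition \<open>W\<close> and, at the same time, keeps all blue degrees
  small.\<close>

lemma bob_bounds_degrees:
  fixes p q N :: nat
  assumes win: "alice_has_winning_strategy p q (complete_graph N) W"
  shows "\<exists>\<alpha> \<beta>. W \<alpha> \<beta> \<and> (\<forall>k. (\<Union>i\<le>k. \<alpha> i) \<subseteq> complete_graph N \<and>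
    (\<forall>v. real (degree (\<Union>i\<le>k. \<alpha> i) v) * (2 * real p + real q)
         \<le> 2 * real p * real N + 4 * real p * real q * sqrt (real N)))"
proof -
  define E where "E = complete_graph N"
  have finE: "finite E" by (simp add: E_def finite_complete_graph)
  have two: "\<And>e. e \<in> E \<Longrightarrow> card e = 2" and VE: "\<Union>E \<subseteq> {..<N}"
    by (auto simp: E_def complete_graph_def nsets_def)
  obtain \<sigma> where \<sigma>: "\<And>\<beta>. bob_legal q E (alice_moves \<sigma> \<beta>) \<beta> \<Longrightarrow>
      alice_legal p E (alice_moves \<sigma> \<beta>) \<beta> \<and> W (alice_moves \<sigma> \<beta>) \<beta>"
    using win unfolding alice_has_winning_strategy_def E_def by blast
  \<comment> \<open>Bob's rule must be legal in every position but can restore balance only in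
    balanced ones, hence the implication.\<close>
  have "\<exists>M. legal_move q (E - (B \<union> R)) M \<and>
      (finite R \<and> balanced p q N E q B R \<longrightarrow> balanced p q N E 0 B (R \<union> M))" for B R
    using greedy_move[OF finE two, of R q q p N B] ex_legal_move by blast
  then obtain g where g: "\<And>B R. legal_move q (E - (B \<union> R)) (g B R)"
    "\<And>B R. finite R \<Longrightarrow> balanced p q N E q B R \<Longrightarrow> balanced p q N E 0 B (R \<union> g B R)"
    by metis
  obtain \<beta> where \<beta>: "\<And>k. \<beta> k = g (\<Union>i\<le>k. alice_moves \<sigma> \<beta> i) (\<Union>i<k. \<beta> i)"
    using ex_response[of g \<sigma>] by blast
  define \<alpha> where "\<alpha> = alice_moves \<sigma> \<beta>"
  have bl: "bob_legal q E \<alpha> \<beta>"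
    unfolding bob_legal_def \<alpha>_def using g(1) \<beta> by metis
  then have al: "alice_legal p E \<alpha> \<beta>" and W: "W \<alpha> \<beta>"
    using \<sigma> by (auto simp: \<alpha>_def)
  define B R where "B k = (\<Union>i<k. \<alpha> i)" and "R k = (\<Union>i<k. \<beta> i)" for k
  have B_Suc: "B (Suc k) = B k \<union> \<alpha> k" and R_Suc: "R (Suc k) = R k \<union> \<beta> k" for k
    by (auto simp: B_def R_def lessThan_Suc)
  have \<alpha>: "\<alpha> k \<subseteq> E - (B k \<union> R k)" "card (\<alpha> k) \<le> p" for k
    using al by (auto simp: alice_legal_def legal_move_def B_def R_def)
  have \<beta>_sub: "\<beta> k \<subseteq> E - (B (Suc k) \<union> R k)" for k
    using bob_legal_subset[OF bl] by (simp add: B_def R_def lessThan_Suc_atMost)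
  have \<beta>_eq: "\<beta> k = g (B (Suc k)) (R k)" for k
    using \<beta>[of k] by (simp add: B_def R_def \<alpha>_def lessThan_Suc_atMost)
  have BE: "B k \<subseteq> E" and RE: "R k \<subseteq> E" for k
    using \<alpha>(1) \<beta>_sub by (auto simp: B_def R_def)
  have disj: "B k \<inter> R k = {}" for k
  proof (induction k)
    case 0
    show ?case by (simp add: B_def)
  next
    case (Suc k)
    then show ?case using \<alpha>(1)[of k] \<beta>_sub[of k] unfolding B_Suc R_Suc by blast
  qed
  have finB: "finite (B k)" and finR: "finite (R k)" for k
    by (rule finite_subset[OF BE finE], rule finite_subset[OF RE finE])
  \<comment> \<open>This is \<open>debt_bound\<close> at 0. It exceeds the value at 1 by 4pq, which
    leaves room for one turn of Alice.\<close>
  let ?K = "4 * real p * real q * sqrt (real N)"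
  have K: "debt_bound p q N 1 + real p * real q \<le> ?K"
    by (simp add: debt_bound_def algebra_simps)
  have inv: "balanced p q N E 0 (B k) (R k) \<and> (\<forall>v. debt p q (B k) (R k) v \<le> ?K)" for k
  proof (induction k)
    case 0
    have zero: "debt p q (B 0) (R 0) v = 0" for v
      by (simp add: B_def R_def debt_def degree_def)
    have "0 \<le> real (card A) * debt_bound p q N (card A)" if "A \<subseteq> \<Union>(E - (B 0 \<union> R 0))" for A
    proof -
      have "A \<subseteq> {..<N}" using that VE by blast
      then have "card A \<le> N" using card_mono[of "{..<N}" A] by simp
      then show ?thesis by (simp add: debt_bound_def)
    qed
    then show ?case using zero by (simp add: balanced_def)
  next
    case (Suc k)
    have bal: "balanced p q N E q (B (Suc k)) (R k)"
      unfolding B_Suc using Suc by (intro balanced_alice_move[OF two finE finB \<alpha>]) auto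
    have le: "debt p q (B (Suc k)) (R k) v \<le> ?K" for v
      unfolding B_Suc using Suc by (intro debt_alice_move[OF finE finB \<alpha> _ _ K]) auto
    have "debt p q (B (Suc k)) (R (Suc k)) v \<le> debt p q (B (Suc k)) (R k) v" for v
    proof -
      have "degree (R k) v \<le> degree (R (Suc k)) v"
        unfolding degree_def R_Suc using finR[of "Suc k"] by (intro card_mono) (auto simp: R_Suc)
      then show ?thesis by (simp add: debt_def mult_left_mono)
    qed
    then show ?case
      using g(2)[OF finR bal] le \<beta>_eq[of k] R_Suc[of k] by (metis order_trans)
  qed
  have "real (degree (\<Union>i\<le>k. \<alpha> i) v) * (2 * real p + real q)
      \<le> 2 * real p * real N + 4 * real p * real q * sqrt (real N)" for k v
  proof -
    have "degree (B (Suc k)) v + degree (R (Suc k)) v = degree (B (Suc k) \<union> R (Suc k)) v"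
      using degree_Un_disjoint[OF finB finR disj] by simp
    also have "\<dots> \<le> degree E v"
      unfolding degree_def using BE RE finE by (intro card_mono) auto
    also have "\<dots> \<le> N"
      using degree_complete_graph[of N v] by (simp add: E_def)
    finally have "real (degree (B (Suc k)) v) + real (degree (R (Suc k)) v) \<le> real N"
      by linarith
    then have "2 * real p * (real (degree (B (Suc k)) v) + real (degree (R (Suc k)) v))
        \<le> 2 * real p * real N"
      by (intro mult_left_mono) auto
    moreover have "debt p q (B (Suc k)) (R (Suc k)) v \<le> ?K" using inv by blast
    \<comment> \<open>The debt bound reads q * blue <= 2p * red + \<open>?K\<close>; blue + red <= N
      eliminates the red degree.\<close>
    ultimately have "real (degree (B (Suc k)) v) * (2 * real p + real q) \<le> 2 * real p * real N + ?K"
      by (simp add: debt_def algebra_simps)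
    then show ?thesis by (simp add: B_def lessThan_Suc_atMost)
  qed
  moreover have "(\<Union>i\<le>k. \<alpha> i) \<subseteq> complete_graph N" for k
    using BE[of "Suc k"] by (simp add: B_def E_def lessThan_Suc_atMost)
  ultimately show ?thesis using W by blast
qed

section \<open>From the degree bound to the board size\<close>

text \<open>A blue star forces degree \<open>n\<close>, and the degree bound then gives \<epsilon>n
  < 2q sqrt N. Since N <= 2n, this contradicts the lower bound on \<open>n\<close>, which says
  (\<epsilon>n)^2 >= 8q^2 n.\<close>

lemma bob_prevents_star:
  fixes p q n N :: nat and \<epsilon> :: real
  assumes pq: "q \<ge> 1" "p \<ge> q" and "\<epsilon> > 0" and n: "n \<ge> 1" "real n \<ge> 8 * real q ^ 2 / \<epsilon> ^ 2"
    and N: "real N < (1 + real q / (2 * real p) - \<epsilon>) * real n"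
  shows "\<not> alice_has_winning_strategy p q (complete_graph N) (maker_win (star n))"
proof
  assume win: "alice_has_winning_strategy p q (complete_graph N) (maker_win (star n))"
  have p: "real p > 0" using pq by simp
  obtain \<alpha> :: "nat \<Rightarrow> nat set set" and k :: nat where B: "contains_copy (star n) (\<Union>i\<le>k. \<alpha> i)" "(\<Union>i\<le>k. \<alpha> i) \<subseteq> complete_graph N"
    and deg: "\<And>v. real (degree (\<Union>i\<le>k. \<alpha> i) v) * (2 * real p + real q)
       \<le> 2 * real p * real N + 4 * real p * real q * sqrt (real N)"
    using bob_bounds_degrees[OF win] unfolding maker_win_def by metis
  have "finite (\<Union>i\<le>k. \<alpha> i)"
    using B(2) finite_complete_graph finite_subset by blast
  then obtain v where "n \<le> degree (\<Union>i\<le>k. \<alpha> i) v"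
    using B(1) degree_ge_if_contains_star by blast
  then have "real n * (2 * real p + real q) \<le> 
      real (degree (\<Union>i\<le>k. \<alpha> i) v) * (2 * real p + real q)"
    by (intro mult_right_mono) auto
  also note deg[of v]
  finally have lower: "real n * (2 * real p + real q)
      \<le> 2 * real p * real N + 4 * real p * real q * sqrt (real N)" .
  have "2 * real p * real N < 2 * real p * ((1 + real q / (2 * real p) - \<epsilon>) * real n)"
    using N p by simp
  also have "\<dots> = real n * (2 * real p + real q) - 2 * real p * \<epsilon> * real n"
    using p by (simp add: field_simps)
  finally have "2 * real p * (\<epsilon> * real n) < 2 * real p * (2 * real q * sqrt (real N))"
    using lower by (simp add: algebra_simps)
  then have less: "\<epsilon> * real n < 2 * real q * sqrt (real N)"
    using p by simp
  have "(1 + real q / (2 * real p) - \<epsilon>) * real n \<le> 2 * real n"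
  proof (intro mult_right_mono)
    have "real q / (2 * real p) \<le> 1"
      using pq by simp
    then show "1 + real q / (2 * real p) - \<epsilon> \<le> 2"
      using \<open>\<epsilon> > 0\<close> by linarith
  qed simp
  then have "real N \<le> 2 * real n" using N by linarith
  have "(\<epsilon> * real n)\<^sup>2 < (2 * real q * sqrt (real N))\<^sup>2"
    using less \<open>\<epsilon> > 0\<close> by (intro power_strict_mono) auto
  also have "\<dots> = 4 * real q ^ 2 * real N" by (simp add: power_mult_distrib)
  also have "\<dots> \<le> 4 * real q ^ 2 * (2 * real n)"
    using \<open>real N \<le> 2 * real n\<close> by (intro mult_left_mono) auto
  finally have "(\<epsilon>\<^sup>2 * real n) * real n < (8 * real q ^ 2) * real n"
    by (simp add: power_mult_distrib power2_eq_square algebra_simps)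
  then have "\<epsilon>\<^sup>2 * real n < 8 * real q ^ 2"
    by (rule mult_right_less_imp_less) simp
  moreover have "\<epsilon>\<^sup>2 * real n \<ge> 8 * real q ^ 2"
    using n(2) \<open>\<epsilon> > 0\<close> by (simp add: field_simps)
  ultimately show False by simp
qed

theorem theorem2:
  fixes p q :: nat and \<epsilon> :: real
  assumes "q \<ge> 1" and "p \<ge> q" and "\<epsilon> > 0"
  shows "\<exists>n\<^sub>0::nat. \<forall>n\<ge>n\<^sub>0.
           achievement_number p q (star n) \<ge> first_player_number p q (star n) \<and>
           real (first_player_number p q (star n)) \<ge> (1 + real q / (2 * real p) - \<epsilon>) * real n"
proof (intro exI allI impI)
  fix n assume n0: "max 1 (nat \<lceil>8 * real q ^ 2 / \<epsilon> ^ 2\<rceil>) \<le> n"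
  then have n: "n \<ge> 1" "real n \<ge> 8 * real q ^ 2 / \<epsilon> ^ 2" by linarith+
  let ?ach = "\<lambda>N. alice_has_winning_strategy p q (complete_graph N) (achievement_win (star n))"
  let ?mak = "\<lambda>N. alice_has_winning_strategy p q (complete_graph N) (maker_win (star n))"
  \<comment> \<open>The number is a \<open>LEAST\<close>, so some board won by Alice must exist
    before it can be used.\<close>
  have "?ach (achievement_number p q (star n))"
    unfolding achievement_number_def
    using alice_wins_achievement_star[OF assms(2,1) n(1)] by (rule LeastI_ex)
  \<comment> \<open>The same strategy wins the Maker/Breaker game on the same board, since
    \<open>achievement_win\<close> implies \<open>maker_win\<close>. Both inequalities start from
    this.\<close>
  then have mak: "?mak (achievement_number p q (star n))"
    unfolding alice_has_winning_strategy_def achievement_win_def maker_win_def by meson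
  then have "?mak (first_player_number p q (star n))"
    unfolding first_player_number_def by (rule LeastI)
  then have "real (first_player_number p q (star n)) \<ge> (1 + real q / (2 * real p) - \<epsilon>) * real n"
    using bob_prevents_star[OF assms n] by (meson not_le)
  moreover have "first_player_number p q (star n) \<le> achievement_number p q (star n)"
    using mak unfolding first_player_number_def by (rule Least_le)
  ultimately show "achievement_number p q (star n) \<ge> first_player_number p q (star n) \<and>
      real (first_player_number p q (star n)) \<ge> (1 + real q / (2 * real p) - \<epsilon>) * real n"
    by blast
qed

end
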